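(* Let $f:[0,\infty)\to\mathbb{R}$ be a continuous superquadratic function and let $A,B,C,D\in\mathbb{B}(\mathscr{H})_h$ be such that $0\le A\le m\le B\le M\le D$ and $m\le C\le M$, for real numbers $0\le m<M$. Suppose that one of the following conditions holds: (i) $B+C\le A+D$ and $f(m)\le f(M)$; (ii) $A+D\le B+C$ and $f(M)\le f(m)$. Then \begin{align*} &f(B)+f(C)+\frac{B-m}{M-m}f(M-B)+\frac{M-C}{M-m}f(C-m)\\ &\quad+\frac{C-m}{M-m}f(M-C)+\frac{M-B}{M-m}f(B-m)\\ &\le f(A)+f(D)-f(m-A)-\frac{m-A}{M-m}f(M-m)\\ &\quad-f(D-M)-\frac{D-M}{M-m}f(M-m). \end{align*}
   Context: $\mathscr{H}$ is a complex Hilbert space, $\mathbb{B}(\mathscr{H})$ is the algebra of bounded linear operators on $\mathscr{H}$ with identity $I$, and $\mathbb{B}(\mathscr{H})_h$ is its real subspace of self-adjoint operators. For self-adjoint $X,Y$, $X\le Y$ means that $Y-X$ is positive, i.e. $\langle (Y-X)x,x\rangle\ge 0$ for all $x$; a real number $c$ in an operator expression stands for $cI$. A function $f:[0,\infty)\to\mathbb{R}$ is superquadratic if for each $s\ge0$ there exists a constant $c_s\in\mathbb{R}$ such that $f(t)-f(s)-f(|t-s|)\ge c_s(t-s)$ for all $t\ge0$. Functions of self-adjoint operators are defined by the continuous functional calculus. *)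

theory Defs
  imports "HOL-Analysis.Analysis" "HOL-Computational_Algebra.Polynomial"
begin

text \<open>
  A complex Hilbert space, as a Banach space whose real structure is the restriction of a complex
  one. The inner product is linear in its first argument.
\<close>

class complex_hilbert_space = banach +
  fixes scaleC :: "complex \<Rightarrow> 'a \<Rightarrow> 'a"  (infixr "*\<^sub>C" 75)
    and cinner :: "'a \<Rightarrow> 'a \<Rightarrow> complex"
  assumes scaleC_add_right: "a *\<^sub>C (x + y) = a *\<^sub>C x + a *\<^sub>C y"
    and scaleC_add_left: "(a + b) *\<^sub>C x = a *\<^sub>C x + b *\<^sub>C x"
    and scaleC_scaleC: "a *\<^sub>C b *\<^sub>C x = (a * b) *\<^sub>C x"
    and scaleC_of_real: "complex_of_real r *\<^sub>C x = r *\<^sub>R x"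
    and cinner_commute: "cinner x y = cnj (cinner y x)"
    and cinner_add_left: "cinner (x + y) z = cinner x z + cinner y z"
    and cinner_scaleC_left: "cinner (a *\<^sub>C x) y = a * cinner x y"
    and cinner_self_nonneg: "cinner x x \<in> \<real>\<^sub>\<ge>\<^sub>0"
    and cinner_self_eq_0_iff: "cinner x x = 0 \<longleftrightarrow> x = 0"
    and norm_eq_sqrt_cinner: "norm x = sqrt (Re (cinner x x))"

text \<open>
  The library type of bounded operators consists of the real-linear ones, with the usual operator
  norm; the bounded operators on the Hilbert space are those that are complex-linear.
\<close>

definition bounded_ops :: "('a::complex_hilbert_space \<Rightarrow>\<^sub>L 'a) set" where
  "bounded_ops = {T. \<forall>c x. blinfun_apply T (c *\<^sub>C x) = c *\<^sub>C blinfun_apply T x}"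

definition self_adjoint_ops :: "('a::complex_hilbert_space \<Rightarrow>\<^sub>L 'a) set" where
  "self_adjoint_ops = {T \<in> bounded_ops.
     \<forall>x y. cinner (blinfun_apply T x) y = cinner x (blinfun_apply T y)}"

definition op_le :: "('a::complex_hilbert_space \<Rightarrow>\<^sub>L 'a) \<Rightarrow> ('a \<Rightarrow>\<^sub>L 'a) \<Rightarrow> bool"
    (infix "\<preceq>" 50) where
  "X \<preceq> Y \<longleftrightarrow> (\<forall>x. cinner (blinfun_apply (Y - X) x) x \<in> \<real>\<^sub>\<ge>\<^sub>0)"

abbreviation scalar_op :: "real \<Rightarrow> ('a::complex_hilbert_space \<Rightarrow>\<^sub>L 'a)" where
  "scalar_op c \<equiv> c *\<^sub>R id_blinfun"

definition op_spectrum :: "('a::complex_hilbert_space \<Rightarrow>\<^sub>L 'a) \<Rightarrow> complex set" where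
  "op_spectrum A = {z. \<not> (\<exists>S\<in>bounded_ops. \<forall>x.
     blinfun_apply S (blinfun_apply A x - z *\<^sub>C x) = x \<and>
     blinfun_apply A (blinfun_apply S x) - z *\<^sub>C blinfun_apply S x = x)}"

definition poly_op :: "real poly \<Rightarrow> ('a::complex_hilbert_space \<Rightarrow>\<^sub>L 'a) \<Rightarrow> ('a \<Rightarrow>\<^sub>L 'a)" where
  "poly_op p A = (\<Sum>i\<le>degree p. coeff p i *\<^sub>R (((o\<^sub>L) A ^^ i) id_blinfun))"

text \<open>
  Continuous functional calculus of a self-adjoint operator: the unique continuous extension of
  the polynomial calculus from polynomials to continuous functions on the (real) spectrum, i.e.
  \<open>f(A)\<close> is the norm limit of the operators \<open>p\<^sub>n(A)\<close> whenever the real polynomials \<open>p\<^sub>n\<close> converge to \<open>f\<close>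
  uniformly on the spectrum of \<open>A\<close>. It is meaningful only for \<open>A\<close> self-adjoint and \<open>f\<close> continuous on
  the spectrum, and depends only on the values of \<open>f\<close> there.
\<close>

definition cfc :: "(real \<Rightarrow> real) \<Rightarrow> ('a::complex_hilbert_space \<Rightarrow>\<^sub>L 'a) \<Rightarrow> ('a \<Rightarrow>\<^sub>L 'a)" where
  "cfc f A = (THE T. \<forall>p :: nat \<Rightarrow> real poly.
     uniform_limit {t. complex_of_real t \<in> op_spectrum A} (\<lambda>n. poly (p n)) f sequentially
       \<longrightarrow> (\<lambda>n. poly_op (p n) A) \<longlonglongrightarrow> T)"

text \<open>Functions on \<open>[0,\<infinity>)\<close> are total functions of which only the values at \<open>t \<ge> 0\<close> matter.\<close>

definition superquadratic :: "(real \<Rightarrow> real) \<Rightarrow> bool" where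
  "superquadratic f \<longleftrightarrow>
     (\<forall>s\<ge>0. \<exists>c. \<forall>t\<ge>0. f t - f s - f \<bar>t - s\<bar> \<ge> c * (t - s))"

end

theory Submission
  imports Defs "HOL-Computational_Algebra.Fundamental_Theorem_Algebra"
begin

text \<open>
  Everything is compared with the chord of \<open>f\<close> over \<open>[m, M]\<close>, that is, the affine function \<open>L\<close> with
  \<open>L(m) = f(m)\<close> and \<open>L(M) = f(M)\<close>. For \<open>t\<close> in \<open>[m, M]\<close>, the defining inequality of superquadraticity
  with base point \<open>t\<close>, evaluated at \<open>m\<close> and at \<open>M\<close> and averaged so that the unknown slope cancels,
  gives \<open>f(t)\<close> plus two correction terms at most \<open>L(t)\<close> (\<open>superquadratic_le_chord\<close>). Outside the
  interval the base point is the nearer endpoint: the value at the other endpoint bounds the unknown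
  slope, and \<open>f(t)\<close> minus corrections is at least \<open>L(t)\<close> (\<open>chord_le_superquadratic_left\<close> and
  \<open>chord_le_superquadratic_right\<close>). The functional calculus is monotone, additive and
  multiplicative, so the first inequality may be read with \<open>B\<close> and \<open>C\<close> in place of \<open>t\<close>, the second
  with \<open>A\<close> and the third with \<open>D\<close>. As \<open>L\<close> is affine, \<open>L(A) + L(D) - L(B) - L(C)\<close> is the slope
  \<open>(f(M) - f(m)) / (M - m)\<close> times \<open>A + D - B - C\<close>, and either alternative in the hypotheses makes this
  product positive. Adding up gives the claim.

  The remaining work is to show that the functional calculus exists and has these properties.
  It rests on the bound of the norm of \<open>p(A)\<close> by the supremum of \<open>|p|\<close> on the spectrum of a self-adjoint
  \<open>A\<close> (\<open>norm_poly_op_le\<close>), which makes polynomial approximations of a continuous function converge to a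
  limit independent of the approximation. The bound follows from two facts. With \<open>N\<close> the norm of
  \<open>T = p(A)\<close>, the operator \<open>T\<^sup>2 - N\<^sup>2\<close> is not bounded below, because \<open>T\<close> nearly attains its norm
  (\<open>not_bounded_below_norm\<close>). On the other hand \<open>q(A)\<close> is bounded below whenever the real polynomial
  \<open>q\<close> has no root in the spectrum, as one sees factor by factor (\<open>bounded_below_poly_op\<close>). Hence
  \<open>p\<^sup>2 - N\<^sup>2\<close> has a root in the spectrum. Finally, the spectrum lies between the order bounds
  of \<open>A\<close> (\<open>real_spectrum_subset\<close>), so uniform approximation on an interval is enough.
\<close>

section \<open>Inner products\<close>

lemma cinner_add_right: "cinner x (y + z) = cinner x y + cinner x z"
  for x y z :: "'a::complex_hilbert_space"
  by (metis cinner_add_left cinner_commute complex_cnj_add)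

lemma cinner_scaleR_left: "cinner (r *\<^sub>R x) y = of_real r * cinner x y"
  for x y :: "'a::complex_hilbert_space"
  by (metis cinner_scaleC_left scaleC_of_real)

lemma cinner_scaleR_right: "cinner x (r *\<^sub>R y) = of_real r * cinner x y"
  for x y :: "'a::complex_hilbert_space"
  by (metis cinner_commute cinner_scaleR_left complex_cnj_complex_of_real complex_cnj_mult)

lemma cinner_diff_left: "cinner (x - y) z = cinner x z - cinner y z"
  for x y z :: "'a::complex_hilbert_space"
  by (metis add_diff_cancel cinner_add_left diff_add_cancel)

lemma cinner_diff_right: "cinner x (y - z) = cinner x y - cinner x z"
  for x y z :: "'a::complex_hilbert_space"
  by (metis add_diff_cancel cinner_add_right diff_add_cancel)

lemma cinner_self: "cinner x x = of_real ((norm x)\<^sup>2)"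
  for x :: "'a::complex_hilbert_space"
proof -
  have "Re (cinner x x) \<ge> 0 \<and> Im (cinner x x) = 0"
    using cinner_self_nonneg[of x] by (simp add: complex_nonneg_Reals_iff)
  then show ?thesis
    by (simp add: norm_eq_sqrt_cinner complex_eq_iff)
qed

lemma scaleR_scaleC_commute: "r *\<^sub>R (c *\<^sub>C x) = c *\<^sub>C (r *\<^sub>R x)"
  for x :: "'a::complex_hilbert_space"
  by (metis mult.commute scaleC_of_real scaleC_scaleC)

lemma norm_scaleC: "norm (c *\<^sub>C x) = cmod c * norm x"
  for x :: "'a::complex_hilbert_space"
proof -
  have "cinner (c *\<^sub>C x) (c *\<^sub>C x) = (c * cnj c) * cinner x x"
    by (metis cinner_commute cinner_scaleC_left complex_cnj_mult mult.assoc)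
  then have "of_real ((norm (c *\<^sub>C x))\<^sup>2) = complex_of_real ((cmod c * norm x)\<^sup>2)"
    by (simp add: cinner_self complex_norm_square power_mult_distrib del: of_real_power)
  then have "(norm (c *\<^sub>C x))\<^sup>2 = (cmod c * norm x)\<^sup>2"
    using of_real_eq_iff by blast
  then show ?thesis
    by (simp add: power2_eq_iff_nonneg)
qed

lemma Re_cinner_commute: "Re (cinner y x) = Re (cinner x y)"
  for x y :: "'a::complex_hilbert_space"
  by (subst cinner_commute) simp

lemma norm_diff_squared:
  "(norm (x - y))\<^sup>2 = (norm x)\<^sup>2 - 2 * Re (cinner x y) + (norm y)\<^sup>2"
  for x y :: "'a::complex_hilbert_space"
proof -
  have "Re (cinner (x - y) (x - y)) = Re (cinner x x) - 2 * Re (cinner x y) + Re (cinner y y)"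
    by (simp add: cinner_diff_left cinner_diff_right Re_cinner_commute[of y x])
  then show ?thesis
    by (simp add: cinner_self)
qed

lemma Re_cinner_le: "Re (cinner x y) \<le> norm x * norm y"
  for x y :: "'a::complex_hilbert_space"
proof (cases "x = 0 \<or> y = 0")
  case True
  have "cinner (0::'a) u = 0" "cinner u (0::'a) = 0" for u
    using cinner_scaleR_left[of 0 0 u] cinner_scaleR_right[of u 0 0] by auto
  with True show ?thesis by auto
next
  case False
  \<comment> \<open>Cauchy--Schwarz: the two rescaled vectors have the same norm, so this square is a multiple of the defect.\<close>
  have "(norm (norm y *\<^sub>R x - norm x *\<^sub>R y))\<^sup>2
      = 2 * (norm x * norm y) * (norm x * norm y - Re (cinner x y))"
    by (simp add: norm_diff_squared cinner_scaleR_left cinner_scaleR_right)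
       (simp add: algebra_simps power2_eq_square)
  then have "0 \<le> 2 * (norm x * norm y) * (norm x * norm y - Re (cinner x y))"
    by (metis zero_le_power2)
  moreover have "0 < norm x * norm y"
    using False by simp
  ultimately show ?thesis
    by (auto simp: zero_le_mult_iff)
qed

lemma cmod_cinner_le: "cmod (cinner x y) \<le> norm x * norm y"
  for x y :: "'a::complex_hilbert_space"
proof (cases "cinner x y = 0")
  case False
  \<comment> \<open>Rotating \<open>x\<close> by this phase makes the inner product real and nonnegative.\<close>
  define u where "u = cnj (sgn (cinner x y))"
  have u: "cmod u = 1"
    using False by (simp add: u_def norm_sgn)
  have "u * cinner x y = cmod (cinner x y)"
    using False by (simp add: u_def sgn_eq mult.commute complex_norm_square[symmetric] power2_eq_square)
  then have "cmod (cinner x y) = Re (cinner (u *\<^sub>C x) y)"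
    by (simp add: cinner_scaleC_left)
  also have "\<dots> \<le> norm x * norm y"
    using Re_cinner_le[of "u *\<^sub>C x" y] u by (simp add: norm_scaleC)
  finally show ?thesis .
qed simp

lemma tendsto_cinner_left:
  fixes X :: "'b \<Rightarrow> 'a::complex_hilbert_space"
  assumes "(X \<longlongrightarrow> x) F"
  shows "((\<lambda>n. cinner (X n) y) \<longlongrightarrow> cinner x y) F"
proof -
  have "((\<lambda>n. norm (X n - x) * norm y) \<longlongrightarrow> 0) F"
    using assms by (auto intro!: tendsto_mult_left_zero tendsto_norm_zero LIM_zero)
  then have "((\<lambda>n. cinner (X n) y - cinner x y) \<longlongrightarrow> 0) F"
    by (rule Lim_null_comparison[rotated])
       (auto simp: cinner_diff_left[symmetric] intro!: always_eventually cmod_cinner_le)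
  then show ?thesis by (rule LIM_zero_cancel)
qed

section \<open>Self-adjoint operators and their order\<close>

lemma self_adjointD:
  assumes "A \<in> self_adjoint_ops"
  shows "cinner (blinfun_apply A x) y = cinner x (blinfun_apply A y)"
  using assms by (simp add: self_adjoint_ops_def)

lemma scalar_op_self_adjoint: "scalar_op c \<in> self_adjoint_ops"
  by (simp add: self_adjoint_ops_def bounded_ops_def blinfun.scaleR_left cinner_scaleR_left
      cinner_scaleR_right scaleR_scaleC_commute)

lemma self_adjoint_add:
  "A \<in> self_adjoint_ops \<Longrightarrow> B \<in> self_adjoint_ops \<Longrightarrow> A + B \<in> self_adjoint_ops"
  by (simp add: self_adjoint_ops_def bounded_ops_def blinfun.add_left cinner_add_left
      cinner_add_right scaleC_add_right)

lemma self_adjoint_compose: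
  assumes "A \<in> self_adjoint_ops" "B \<in> self_adjoint_ops" "A o\<^sub>L B = B o\<^sub>L A"
  shows "A o\<^sub>L B \<in> self_adjoint_ops"
proof -
  have "blinfun_apply A (blinfun_apply B x) = blinfun_apply B (blinfun_apply A x)" for x
    by (metis assms(3) blinfun_apply_blinfun_compose)
  then show ?thesis
    using assms(1,2) by (simp add: self_adjoint_ops_def bounded_ops_def)
qed

lemma self_adjoint_scaleR:
  assumes "A \<in> self_adjoint_ops"
  shows "r *\<^sub>R A \<in> self_adjoint_ops"
  using assms
  by (simp add: self_adjoint_ops_def bounded_ops_def blinfun.scaleR_left cinner_scaleR_left
      cinner_scaleR_right scaleR_scaleC_commute)

lemma self_adjoint_diff:
  "A \<in> self_adjoint_ops \<Longrightarrow> B \<in> self_adjoint_ops \<Longrightarrow> A - B \<in> self_adjoint_ops"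
  using self_adjoint_add[of A "(- 1) *\<^sub>R B"] self_adjoint_scaleR[of B "- 1"] by simp

text \<open>
  The order asks for the quadratic form of the difference to be real and nonnegative; for
  self-adjoint operators reality is automatic.
\<close>

lemma op_le_iff_Re:
  assumes "A \<in> self_adjoint_ops" "B \<in> self_adjoint_ops"
  shows "A \<preceq> B \<longleftrightarrow> (\<forall>x. Re (cinner (blinfun_apply A x) x) \<le> Re (cinner (blinfun_apply B x) x))"
proof -
  have "Im (cinner (blinfun_apply (B - A) x) x) = 0" for x
    using self_adjointD[OF self_adjoint_diff[OF assms(2,1)], of x x]
      cinner_commute[of x "blinfun_apply (B - A) x"]
    by (simp add: complex_eq_iff)
  then show ?thesis
    by (auto simp: op_le_def complex_nonneg_Reals_iff blinfun.diff_left cinner_diff_left)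
qed

lemma Re_cinner_scalar_op: "Re (cinner (blinfun_apply (scalar_op c) x) x) = c * (norm x)\<^sup>2"
  by (simp add: blinfun.scaleR_left cinner_scaleR_left cinner_self)

lemma op_le_add: "A \<preceq> B \<Longrightarrow> C \<preceq> D \<Longrightarrow> A + C \<preceq> B + D"
  by (auto simp: op_le_def blinfun.diff_left blinfun.add_left cinner_diff_left cinner_add_left
      complex_nonneg_Reals_iff algebra_simps)
     (smt (verit, best))+

lemma op_le_trans: "A \<preceq> B \<Longrightarrow> B \<preceq> C \<Longrightarrow> A \<preceq> C"
  using op_le_add[of A B B C] by (simp add: op_le_def)

text \<open>
  The order depends only on differences, so an inequality between operator expressions can be
  transferred along an algebraic identity.
\<close>

lemma op_le_cong_diff: "A \<preceq> B \<Longrightarrow> B - A = D - C \<Longrightarrow> C \<preceq> D"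
  by (simp add: op_le_def)

lemma op_le_scaleR: "A \<preceq> B \<Longrightarrow> 0 \<le> r \<Longrightarrow> r *\<^sub>R A \<preceq> r *\<^sub>R B"
  by (auto simp: op_le_def blinfun.diff_left blinfun.scaleR_left cinner_diff_left cinner_scaleR_left
      complex_nonneg_Reals_iff mult_left_mono simp flip: right_diff_distrib)

lemma op_le_tendsto:
  fixes S T :: "nat \<Rightarrow> 'a::complex_hilbert_space \<Rightarrow>\<^sub>L 'a"
  assumes "S \<longlonglongrightarrow> A" "T \<longlonglongrightarrow> B" and "\<And>n. S n \<preceq> T n"
  shows "A \<preceq> B"
  unfolding op_le_def
proof
  fix x
  have "(\<lambda>n. cinner (blinfun_apply (T n - S n) x) x)
      \<longlonglongrightarrow> cinner (blinfun_apply (B - A) x) x"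
    by (intro tendsto_cinner_left tendsto_intros assms)
  then show "cinner (blinfun_apply (B - A) x) x \<in> \<real>\<^sub>\<ge>\<^sub>0"
    by (rule Lim_in_closed_set[rotated 3])
       (use assms(3) in \<open>auto simp: op_le_def\<close>)
qed

lemma op_le_norm:
  assumes "A \<in> self_adjoint_ops"
  shows "A \<preceq> scalar_op (norm A)"
proof -
  have "Re (cinner (blinfun_apply A x) x) \<le> norm A * (norm x)\<^sup>2" for x
  proof -
    have "Re (cinner (blinfun_apply A x) x) \<le> norm (blinfun_apply A x) * norm x"
      by (rule Re_cinner_le)
    also have "\<dots> \<le> norm A * norm x * norm x"
      by (intro mult_right_mono norm_blinfun) auto
    finally show ?thesis by (simp add: power2_eq_square mult.assoc)
  qed
  then show ?thesis
    unfolding op_le_iff_Re[OF assms scalar_op_self_adjoint] Re_cinner_scalar_op by blast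
qed

section \<open>Location of the spectrum\<close>

text \<open>
  The Lax--Milgram argument. For a suitable step size \<open>a\<close> the Richardson iteration
  \<open>x \<mapsto> x - a (P x - y)\<close> is a contraction, and its fixed point solves \<open>P x = y\<close>; coercivity also makes
  \<open>P\<close> bounded below, which bounds the inverse.
\<close>

lemma coercive_invertible:
  fixes P :: "'a::complex_hilbert_space \<Rightarrow>\<^sub>L 'a"
  assumes P: "P \<in> bounded_ops" and c: "c > 0"
    and coercive: "\<And>x. c * (norm x)\<^sup>2 \<le> Re (cinner (blinfun_apply P x) x)"
  shows "\<exists>S\<in>bounded_ops. \<forall>x. blinfun_apply S (blinfun_apply P x) = x \<and>
                               blinfun_apply P (blinfun_apply S x) = x"
proof -
  have below: "c * norm x \<le> norm (blinfun_apply P x)" for x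
  proof (cases "x = 0")
    case False
    have "c * norm x * norm x \<le> norm (blinfun_apply P x) * norm x"
      using coercive[of x] Re_cinner_le[of "blinfun_apply P x" x]
      by (simp add: power2_eq_square mult.assoc)
    with False show ?thesis by simp
  qed simp
  have inj: "x = y" if "blinfun_apply P x = blinfun_apply P y" for x y
  proof -
    have "c * norm (x - y) \<le> 0"
      using below[of "x - y"] that by (simp add: blinfun.diff_right)
    with c show ?thesis
      by (smt (verit, ccfv_threshold) mult_pos_pos norm_le_zero_iff right_minus_eq zero_less_norm_iff)
  qed
  \<comment> \<open>Adding \<open>c\<close> to the norm keeps \<open>K\<close> positive and at least \<open>c\<close>, so the square root below is real.\<close>
  define K where "K = norm P + c"
  have K: "K > 0" "norm P \<le> K" "c \<le> K"
    using c by (auto simp: K_def add_nonneg_pos)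
  \<comment> \<open>The minimiser of \<open>1 - 2 a c + a\<^sup>2 K\<^sup>2\<close>, which bounds the squared contraction factor.\<close>
  define a where "a = c / K\<^sup>2"
  define k where "k = sqrt (1 - (c / K)\<^sup>2)"
  have "(c / K)\<^sup>2 \<le> 1"
    using K c by (simp add: power_le_one_iff)
  then have k: "0 \<le> k" "k < 1" "k\<^sup>2 = 1 - (c / K)\<^sup>2"
    using K c by (auto simp: k_def)
  have contr: "norm (x - a *\<^sub>R blinfun_apply P x) \<le> k * norm x" for x
  proof -
    have "norm (blinfun_apply P x) \<le> K * norm x"
      using norm_blinfun[of P x] K(2) by (meson mult_right_mono norm_ge_zero order_trans)
    then have "(norm (blinfun_apply P x))\<^sup>2 \<le> K\<^sup>2 * (norm x)\<^sup>2"
      by (metis norm_ge_zero power_mono power_mult_distrib)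
    then have 1: "a\<^sup>2 * (norm (blinfun_apply P x))\<^sup>2 \<le> a\<^sup>2 * (K\<^sup>2 * (norm x)\<^sup>2)"
      by (intro mult_left_mono) auto
    have 2: "a * (c * (norm x)\<^sup>2) \<le> a * Re (cinner x (blinfun_apply P x))"
      using coercive[of x] c Re_cinner_commute[of x "blinfun_apply P x"]
      by (intro mult_left_mono) (auto simp: a_def)
    have "(norm (x - a *\<^sub>R blinfun_apply P x))\<^sup>2
        = (norm x)\<^sup>2 - 2 * (a * Re (cinner x (blinfun_apply P x)))
            + a\<^sup>2 * (norm (blinfun_apply P x))\<^sup>2"
      by (simp add: norm_diff_squared cinner_scaleR_right power_mult_distrib)
    also have "\<dots> \<le> (norm x)\<^sup>2 - 2 * (a * (c * (norm x)\<^sup>2)) + a\<^sup>2 * (K\<^sup>2 * (norm x)\<^sup>2)"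
      using 1 2 by linarith
    also have "\<dots> = (1 - (c / K)\<^sup>2) * (norm x)\<^sup>2"
      using K by (simp add: a_def field_simps power2_eq_square)
    also have "\<dots> = (k * norm x)\<^sup>2"
      by (simp add: power_mult_distrib k(3))
    finally show ?thesis
      by (rule power2_le_imp_le) (use k in simp)
  qed
  have surj: "\<exists>x. blinfun_apply P x = y" for y
  proof -
    define g where "g x = x - a *\<^sub>R blinfun_apply P x + a *\<^sub>R y" for x
    have "dist (g u) (g v) \<le> k * dist u v" for u v
    proof -
      have "g u - g v = (u - v) - a *\<^sub>R blinfun_apply P (u - v)"
        by (simp add: g_def blinfun.diff_right scaleR_diff_right)
      then show ?thesis
        using contr[of "u - v"] by (simp add: dist_norm)
    qed
    then have "\<exists>!x. g x = x"
      using k by (intro banach_fix_type) auto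
    then obtain x where "g x = x" by blast
    then have "a *\<^sub>R blinfun_apply P x = a *\<^sub>R y"
      by (auto simp: g_def)
    moreover have "a \<noteq> 0"
      using c K by (simp add: a_def)
    ultimately show ?thesis by auto
  qed
  define s where "s y = (SOME x. blinfun_apply P x = y)" for y
  have Ps: "blinfun_apply P (s y) = y" for y
    unfolding s_def by (rule someI_ex[OF surj])
  have "bounded_linear s"
  proof (rule bounded_linear_intro)
    show "s (x + y) = s x + s y" for x y by (rule inj) (simp add: Ps blinfun.add_right)
    show "s (r *\<^sub>R x) = r *\<^sub>R s x" for r x by (rule inj) (simp add: Ps blinfun.scaleR_right)
    show "norm (s x) \<le> norm x * (1 / c)" for x
      using below[of "s x"] c by (simp add: Ps field_simps)
  qed
  then have S: "blinfun_apply (Blinfun s) = s"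
    by (rule bounded_linear_Blinfun_apply)
  have "s (z *\<^sub>C x) = z *\<^sub>C s x" for z x
    by (rule inj) (use P in \<open>simp add: Ps bounded_ops_def\<close>)
  then have "Blinfun s \<in> bounded_ops"
    by (simp add: bounded_ops_def S)
  moreover have "s (blinfun_apply P x) = x" for x
    by (rule inj) (simp add: Ps)
  ultimately show ?thesis
    by (intro bexI[of _ "Blinfun s"]) (simp_all add: S Ps)
qed

text \<open>
  The order bounds stand in for the spectrum throughout: they are what the hypotheses provide,
  and they are inherited by affine images of the operator.
\<close>

definition spectral_bounds :: "real \<Rightarrow> real \<Rightarrow> ('a::complex_hilbert_space \<Rightarrow>\<^sub>L 'a) \<Rightarrow> bool" where
  "spectral_bounds a b A \<longleftrightarrow> A \<in> self_adjoint_ops \<and> scalar_op a \<preceq> A \<and> A \<preceq> scalar_op b"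

abbreviation real_spectrum :: "('a::complex_hilbert_space \<Rightarrow>\<^sub>L 'a) \<Rightarrow> real set" where
  "real_spectrum A \<equiv> {t. complex_of_real t \<in> op_spectrum A}"

text \<open>
  For \<open>t < a\<close> the operator \<open>A - t\<close> is coercive, and for \<open>t > b\<close> its negative is; either way \<open>A - t\<close> is
  invertible.
\<close>

lemma real_spectrum_subset:
  fixes A :: "'a::complex_hilbert_space \<Rightarrow>\<^sub>L 'a"
  assumes "spectral_bounds a b A"
  shows "real_spectrum A \<subseteq> {a..b}"
proof
  fix t assume "t \<in> real_spectrum A"
  then have t: "complex_of_real t \<in> op_spectrum A" by simp
  have A: "A \<in> self_adjoint_ops"
    using assms by (simp add: spectral_bounds_def)
  have a: "\<And>x. a * (norm x)\<^sup>2 \<le> Re (cinner (blinfun_apply A x) x)"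
    and b: "\<And>x. Re (cinner (blinfun_apply A x) x) \<le> b * (norm x)\<^sup>2"
    using assms unfolding spectral_bounds_def op_le_iff_Re[OF scalar_op_self_adjoint A]
      op_le_iff_Re[OF A scalar_op_self_adjoint] Re_cinner_scalar_op by auto
  \<comment> \<open>The sign \<open>r = \<plusminus>1\<close> treats the two sides of the interval together; \<open>r\<close> is its own inverse.\<close>
  have not_coercive: False
    if r: "r\<^sup>2 = 1" and c: "c > 0"
      and co: "\<And>x. c * (norm x)\<^sup>2 \<le> r * (Re (cinner (blinfun_apply A x) x) - t * (norm x)\<^sup>2)"
    for r c
  proof -
    define P where "P = r *\<^sub>R (A - scalar_op t)"
    have "P \<in> self_adjoint_ops"
      unfolding P_def by (intro self_adjoint_scaleR self_adjoint_diff A scalar_op_self_adjoint)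
    then have "P \<in> bounded_ops"
      by (simp add: self_adjoint_ops_def)
    moreover have "c * (norm x)\<^sup>2 \<le> Re (cinner (blinfun_apply P x) x)" for x
      using co[of x] by (simp add: P_def blinfun.scaleR_left blinfun.diff_left cinner_scaleR_left
          cinner_diff_left cinner_self)
    ultimately obtain S where S: "S \<in> bounded_ops"
      "\<And>x. blinfun_apply S (blinfun_apply P x) = x" "\<And>x. blinfun_apply P (blinfun_apply S x) = x"
      using coercive_invertible[OF _ c, of P] by blast
    have "r *\<^sub>R S \<in> bounded_ops"
      using S(1) by (simp add: bounded_ops_def blinfun.scaleR_left scaleR_scaleC_commute)
    moreover have "blinfun_apply (r *\<^sub>R S) (blinfun_apply A x - complex_of_real t *\<^sub>C x) = x" for x
      using S(2)[of x] by (simp add: P_def scaleC_of_real blinfun.scaleR_left blinfun.diff_left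
          blinfun.scaleR_right)
    moreover have "blinfun_apply A (blinfun_apply (r *\<^sub>R S) x)
        - complex_of_real t *\<^sub>C blinfun_apply (r *\<^sub>R S) x = x" for x
      using S(3)[of x] by (simp add: P_def scaleC_of_real blinfun.scaleR_left blinfun.diff_left
          blinfun.scaleR_right scaleR_diff_right mult.commute)
    ultimately show False
      using t unfolding op_spectrum_def by blast
  qed
  have "\<not> t < a"
    using not_coercive[of 1 "a - t"] a by (auto simp: algebra_simps)
  moreover have "\<not> b < t"
    using not_coercive[of "- 1" "t - b"] b by (auto simp: algebra_simps)
  ultimately show "t \<in> {a..b}" by auto
qed

section \<open>The polynomial calculus\<close>

lemma poly_op_eq_sum:
  assumes "degree p \<le> n"
  shows "poly_op p A = (\<Sum>i\<le>n. coeff p i *\<^sub>R (((o\<^sub>L) A ^^ i) id_blinfun))"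
  unfolding poly_op_def using assms
  by (intro sum.mono_neutral_left) (auto simp: coeff_eq_0)

lemma poly_op_0 [simp]: "poly_op 0 A = 0"
  by (simp add: poly_op_def)

lemma blinfun_compose_add_left: "(A + B) o\<^sub>L C = (A o\<^sub>L C) + (B o\<^sub>L C)"
  by (rule bounded_bilinear.add_left[OF bounded_bilinear_blinfun_compose])

lemma blinfun_compose_add_right: "A o\<^sub>L (B + C) = (A o\<^sub>L B) + (A o\<^sub>L C)"
  by (rule bounded_bilinear.add_right[OF bounded_bilinear_blinfun_compose])

lemma blinfun_compose_scaleR_left: "(r *\<^sub>R A) o\<^sub>L B = r *\<^sub>R (A o\<^sub>L B)"
  by (rule bounded_bilinear.scaleR_left[OF bounded_bilinear_blinfun_compose])

lemma blinfun_compose_scaleR_right: "A o\<^sub>L (r *\<^sub>R B) = r *\<^sub>R (A o\<^sub>L B)"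
  by (rule bounded_bilinear.scaleR_right[OF bounded_bilinear_blinfun_compose])

lemma blinfun_compose_id [simp]: "A o\<^sub>L id_blinfun = A" "id_blinfun o\<^sub>L A = A"
  by (simp_all add: blinfun_eqI)

text \<open>
  Horner form of the polynomial calculus. It makes the homomorphism properties below
  inductions over the coefficients.
\<close>

lemma poly_op_pCons: "poly_op (pCons c p) A = scalar_op c + (A o\<^sub>L poly_op p A)"
proof -
  have "poly_op (pCons c p) A
      = (\<Sum>i\<le>Suc (degree p). coeff (pCons c p) i *\<^sub>R (((o\<^sub>L) A ^^ i) id_blinfun))"
    by (rule poly_op_eq_sum) (simp add: degree_pCons_le)
  also have "\<dots> = scalar_op c
      + (\<Sum>i\<le>degree p. coeff p i *\<^sub>R (A o\<^sub>L ((o\<^sub>L) A ^^ i) id_blinfun))"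
    by (subst sum.atMost_Suc_shift) simp
  also have "(\<Sum>i\<le>degree p. coeff p i *\<^sub>R (A o\<^sub>L ((o\<^sub>L) A ^^ i) id_blinfun)) = A o\<^sub>L poly_op p A"
    by (simp add: poly_op_def bounded_bilinear.sum_right[OF bounded_bilinear_blinfun_compose]
        blinfun_compose_scaleR_right)
  finally show ?thesis .
qed

lemma poly_op_const: "poly_op [:c:] A = scalar_op c"
  by (simp add: poly_op_pCons)

lemma poly_op_linear: "poly_op [:c, d:] A = scalar_op c + d *\<^sub>R A"
  by (simp add: poly_op_pCons blinfun_compose_scaleR_right)

lemma poly_op_add: "poly_op (p + q) A = poly_op p A + poly_op q A"
  by (induction p q rule: poly_induct2)
     (simp_all add: poly_op_pCons blinfun_compose_add_right scaleR_add_left)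

lemma poly_op_smult: "poly_op (smult c p) A = c *\<^sub>R poly_op p A"
  by (induction p)
     (simp_all add: poly_op_pCons blinfun_compose_scaleR_right scaleR_add_right)

lemma poly_op_diff: "poly_op (p - q) A = poly_op p A - poly_op q A"
  using poly_op_add[of "p - q" q A] by simp

lemma poly_op_mult: "poly_op (p * q) A = poly_op p A o\<^sub>L poly_op q A"
  by (induction p)
     (simp_all add: poly_op_pCons poly_op_add poly_op_smult blinfun_compose_add_left
       blinfun_compose_scaleR_left blinfun_eqI)

lemma poly_op_pcompose: "poly_op (pcompose p q) A = poly_op p (poly_op q A)"
  by (induction p)
     (simp_all add: pcompose_pCons poly_op_pCons poly_op_add poly_op_mult)

lemma poly_op_self_adjoint:
  assumes "A \<in> self_adjoint_ops"
  shows "poly_op p A \<in> self_adjoint_ops"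
proof (induction p)
  case 0
  show ?case using scalar_op_self_adjoint[of 0] by simp
next
  case (pCons c p)
  have X: "poly_op [:0, 1:] A = A"
    by (simp add: poly_op_linear)
  have "A o\<^sub>L poly_op p A = poly_op p A o\<^sub>L A"
    by (metis X poly_op_mult mult.commute)
  then show ?case
    unfolding poly_op_pCons
    by (intro self_adjoint_add scalar_op_self_adjoint self_adjoint_compose assms pCons.IH)
qed

section \<open>The norm of a polynomial in a self-adjoint operator\<close>

text \<open>
  Being bounded below replaces invertibility here: it passes to products without constructing
  an inverse, it fails for \<open>T\<^sup>2 - \<parallel>T\<parallel>\<^sup>2\<close> by a computation with norms, and it holds for \<open>A - t\<close> off
  the spectrum.
\<close>

definition bounded_below :: "('a::real_normed_vector \<Rightarrow>\<^sub>L 'a) \<Rightarrow> bool" where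
  "bounded_below T \<longleftrightarrow> (\<exists>c>0. \<forall>x. c * norm x \<le> norm (blinfun_apply T x))"

lemma bounded_below_compose:
  assumes "bounded_below S" "bounded_below T"
  shows "bounded_below (S o\<^sub>L T)"
proof -
  obtain c d where cd: "c > 0" "d > 0" "\<And>x. c * norm x \<le> norm (blinfun_apply S x)"
      "\<And>x. d * norm x \<le> norm (blinfun_apply T x)"
    using assms unfolding bounded_below_def by blast
  have "(c * d) * norm x \<le> norm (blinfun_apply (S o\<^sub>L T) x)" for x
  proof -
    have "(c * d) * norm x \<le> c * norm (blinfun_apply T x)"
      using cd by (simp add: mult.assoc)
    also have "\<dots> \<le> norm (blinfun_apply S (blinfun_apply T x))"
      by (rule cd)
    finally show ?thesis by simp
  qed
  then show ?thesis
    unfolding bounded_below_def using cd by (intro exI[of _ "c * d"]) auto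
qed

lemma bounded_below_scalar_op:
  assumes "c \<noteq> 0"
  shows "bounded_below (c *\<^sub>R id_blinfun)"
  unfolding bounded_below_def using assms
  by (intro exI[of _ "\<bar>c\<bar>"]) (simp add: blinfun.scaleR_left)

lemma bounded_below_linear_factor:
  assumes "t \<notin> real_spectrum A"
  shows "bounded_below (poly_op [:- t, 1:] A)"
proof -
  obtain S where S: "\<And>x. blinfun_apply S (blinfun_apply A x - complex_of_real t *\<^sub>C x) = x"
    using assms unfolding op_spectrum_def by auto
  have K: "norm S + 1 > 0"
    by (simp add: add_nonneg_pos)
  have "norm x \<le> (norm S + 1) * norm (blinfun_apply (poly_op [:- t, 1:] A) x)" for x
  proof -
    have "blinfun_apply (poly_op [:- t, 1:] A) x = blinfun_apply A x - complex_of_real t *\<^sub>C x"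
      by (simp add: poly_op_linear blinfun.diff_left blinfun.add_left blinfun.scaleR_left
          blinfun.minus_left scaleC_of_real)
    then have "norm x \<le> norm S * norm (blinfun_apply (poly_op [:- t, 1:] A) x)"
      using S norm_blinfun[of S] by metis
    also have "\<dots> \<le> (norm S + 1) * norm (blinfun_apply (poly_op [:- t, 1:] A) x)"
      by (intro mult_right_mono) auto
    finally show ?thesis .
  qed
  then show ?thesis
    unfolding bounded_below_def using K
    by (intro exI[of _ "1 / (norm S + 1)"]) (simp add: field_simps)
qed

text \<open>
  A pair of conjugate roots \<open>a \<plusminus> b i\<close> never obstructs: the factor is \<open>(A - a)\<^sup>2 + b\<^sup>2\<close>, whose
  quadratic form is at least \<open>b\<^sup>2\<close> because \<open>(A - a)\<^sup>2\<close> is positive.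
\<close>

lemma bounded_below_quadratic_factor:
  fixes A :: "'a::complex_hilbert_space \<Rightarrow>\<^sub>L 'a"
  assumes A: "A \<in> self_adjoint_ops" and b: "b \<noteq> 0"
  shows "bounded_below (poly_op [:a\<^sup>2 + b\<^sup>2, - 2 * a, 1:] A)"
proof -
  define T where "T = poly_op [:- a, 1:] A"
  have T: "T \<in> self_adjoint_ops"
    unfolding T_def by (rule poly_op_self_adjoint[OF A])
  have "[:a\<^sup>2 + b\<^sup>2, - 2 * a, 1:] = [:- a, 1:] * [:- a, 1:] + [:b\<^sup>2:]"
    by (simp add: power2_eq_square)
  then have Q: "poly_op [:a\<^sup>2 + b\<^sup>2, - 2 * a, 1:] A = (T o\<^sub>L T) + scalar_op (b\<^sup>2)"
    by (simp only: poly_op_add poly_op_mult poly_op_const T_def)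
  have "b\<^sup>2 * norm x \<le> norm (blinfun_apply ((T o\<^sub>L T) + scalar_op (b\<^sup>2)) x)" for x
  proof (cases "x = 0")
    case False
    have "b\<^sup>2 * norm x * norm x \<le> (norm (blinfun_apply T x))\<^sup>2 + b\<^sup>2 * (norm x)\<^sup>2"
      by (simp add: power2_eq_square)
    also have "\<dots> = Re (cinner (blinfun_apply ((T o\<^sub>L T) + scalar_op (b\<^sup>2)) x) x)"
      by (simp add: blinfun.add_left blinfun.scaleR_left cinner_add_left cinner_scaleR_left
          cinner_self self_adjointD[OF T])
    also have "\<dots> \<le> norm (blinfun_apply ((T o\<^sub>L T) + scalar_op (b\<^sup>2)) x) * norm x"
      by (rule Re_cinner_le)
    finally show ?thesis using False by simp
  qed simp
  then show ?thesis
    unfolding bounded_below_def Q using b by (intro exI[of _ "b\<^sup>2"]) auto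
qed

text \<open>
  The fundamental theorem of algebra over the reals. A non-real root \<open>z\<close> is a root of a real
  quadratic \<open>k\<close>; the remainder of \<open>q\<close> modulo \<open>k\<close> is a real polynomial of degree at most one that
  vanishes at \<open>z\<close>, hence is zero.
\<close>

lemma real_poly_factor:
  fixes q :: "real poly"
  assumes "degree q > 0"
  shows "(\<exists>t. [:- t, 1:] dvd q) \<or> (\<exists>a b. b \<noteq> 0 \<and> [:a\<^sup>2 + b\<^sup>2, - 2 * a, 1:] dvd q)"
proof -
  define cpoly where "cpoly r z = poly (map_poly complex_of_real r) z" for r z
  have cpoly_pCons: "cpoly (pCons c r) z = of_real c + z * cpoly r z" for c r z
    by (simp add: cpoly_def map_poly_pCons)
  have cpoly_0: "cpoly 0 z = 0" for z
    by (simp add: cpoly_def)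
  have cpoly_add: "cpoly (r + s) z = cpoly r z + cpoly s z" for r s z
    by (induction r s rule: poly_induct2) (simp_all add: cpoly_pCons cpoly_0 algebra_simps)
  have cpoly_smult: "cpoly (smult c r) z = of_real c * cpoly r z" for c r z
    by (induction r) (simp_all add: cpoly_pCons cpoly_0 algebra_simps)
  have cpoly_mult: "cpoly (r * s) z = cpoly r z * cpoly s z" for r s z
    by (induction r) (simp_all add: cpoly_pCons cpoly_0 cpoly_add cpoly_smult algebra_simps)
  have cpoly_real: "cpoly r (of_real t) = of_real (poly r t)" for r t
    by (induction r) (simp_all add: cpoly_pCons cpoly_0)
  have "degree (map_poly complex_of_real q) > 0"
    using assms by (simp add: degree_map_poly)
  then have "\<not> constant (poly (map_poly complex_of_real q))"
    by (simp add: constant_degree)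
  then obtain z where z: "cpoly q z = 0"
    unfolding cpoly_def using fundamental_theorem_of_algebra by blast
  show ?thesis
  proof (cases "Im z = 0")
    case True
    then have "z = of_real (Re z)"
      by (simp add: complex_eq_iff)
    with z cpoly_real[of q "Re z"] have "poly q (Re z) = 0"
      by (metis of_real_eq_0_iff)
    then show ?thesis by (auto simp: poly_eq_0_iff_dvd)
  next
    case False
    define k where "k = [:(Re z)\<^sup>2 + (Im z)\<^sup>2, - 2 * Re z, 1:]"
    have "cpoly k z = 0"
      by (simp add: k_def cpoly_pCons cpoly_0 complex_eq_iff power2_eq_square algebra_simps)
    moreover have "q = k * (q div k) + q mod k" by simp
    ultimately have r0: "cpoly (q mod k) z = 0"
      by (metis z cpoly_add cpoly_mult add_0 mult_zero_left)
    have "q mod k = 0 \<or> degree (q mod k) < 2"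
      using degree_mod_less[of k q] by (auto simp: k_def)
    then have "degree (q mod k) \<le> 1" by auto
    moreover obtain c r where c: "q mod k = pCons c r"
      by (rule pCons_cases)
    ultimately have "degree r = 0"
      by (cases "r = 0") auto
    then obtain d where "r = [:d:]"
      by (rule degree_eq_zeroE)
    with c have cd: "q mod k = [:c, d:]" by simp
    from r0 False have "d = 0" "c = 0"
      by (auto simp: cd cpoly_pCons cpoly_0 complex_eq_iff)
    then have "k dvd q"
      using cd by (simp add: dvd_eq_mod_eq_0)
    with False show ?thesis unfolding k_def by blast
  qed
qed

text \<open>
  The half of the spectral mapping theorem that the norm estimate needs, by splitting off real
  linear and quadratic factors one at a time.
\<close>

lemma bounded_below_poly_op:
  assumes A: "A \<in> self_adjoint_ops"
    and "q \<noteq> 0" "\<And>t. t \<in> real_spectrum A \<Longrightarrow> poly q t \<noteq> 0"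
  shows "bounded_below (poly_op q A)"
  using assms(2,3)
proof (induction "degree q" arbitrary: q rule: less_induct)
  case less
  show ?case
  proof (cases "degree q = 0")
    case True
    then obtain c where "q = [:c:]" by (rule degree_eq_zeroE)
    with less.prems(1) show ?thesis
      by (simp add: poly_op_const bounded_below_scalar_op)
  next
    case False
    have step: ?thesis
      if k: "k dvd q" "degree k > 0" "bounded_below (poly_op k A)" for k
    proof -
      obtain r where r: "q = k * r" using k(1) by blast
      have "k \<noteq> 0" "r \<noteq> 0" using less.prems(1) r by auto
      then have "degree r < degree q"
        using k(2) by (simp add: r degree_mult_eq)
      then have "bounded_below (poly_op r A)"
        using \<open>r \<noteq> 0\<close> less.prems(2) r by (intro less.hyps) auto
      then show ?thesis
        unfolding r poly_op_mult by (intro bounded_below_compose k(3))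
    qed
    consider t where "[:- t, 1:] dvd q"
      | a b where "b \<noteq> 0" "[:a\<^sup>2 + b\<^sup>2, - 2 * a, 1:] dvd q"
      using real_poly_factor[of q] False by blast
    then show ?thesis
    proof cases
      case 1
      then have "poly q t = 0" by (simp add: poly_eq_0_iff_dvd)
      then have "t \<notin> real_spectrum A" using less.prems(2) by blast
      then show ?thesis
        using 1 by (intro step[of "[:- t, 1:]"] bounded_below_linear_factor) auto
    next
      case 2
      then show ?thesis
        using bounded_below_quadratic_factor[OF A] by (intro step[of "[:a\<^sup>2 + b\<^sup>2, - 2 * a, 1:]"]) auto
    qed
  qed
qed

text \<open>
  Expanding the square of the norm of \<open>(T\<^sup>2 - N\<^sup>2) x\<close>, a lower bound \<open>c\<close> for \<open>T\<^sup>2 - N\<^sup>2\<close> would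
  give \<open>N\<^sup>2 \<parallel>T x\<parallel>\<^sup>2 \<le> (N\<^sup>4 - c\<^sup>2) \<parallel>x\<parallel>\<^sup>2\<close> for all \<open>x\<close>, and so a norm of \<open>T\<close> strictly below \<open>N\<close>. On the
  zero space every operator is bounded below.
\<close>

lemma not_bounded_below_norm:
  fixes T :: "'a::complex_hilbert_space \<Rightarrow>\<^sub>L 'a"
  assumes T: "T \<in> self_adjoint_ops" and nontrivial: "\<exists>x::'a. x \<noteq> 0"
  shows "\<not> bounded_below ((T o\<^sub>L T) - scalar_op ((norm T)\<^sup>2))"
proof
  define N where "N = norm T"
  assume "bounded_below ((T o\<^sub>L T) - scalar_op ((norm T)\<^sup>2))"
  then obtain c where c: "c > 0"
    "\<And>x. c * norm x \<le> norm (blinfun_apply ((T o\<^sub>L T) - scalar_op (N\<^sup>2)) x)"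
    unfolding bounded_below_def N_def by blast
  have key: "N\<^sup>2 * (norm (blinfun_apply T x))\<^sup>2 \<le> (N ^ 4 - c\<^sup>2) * (norm x)\<^sup>2" for x
  proof -
    let ?y = "blinfun_apply T x"
    have "norm (blinfun_apply T ?y) \<le> N * norm ?y"
      unfolding N_def by (rule norm_blinfun)
    then have TT: "(norm (blinfun_apply T ?y))\<^sup>2 \<le> N\<^sup>2 * (norm ?y)\<^sup>2"
      by (metis norm_ge_zero power_mono power_mult_distrib)
    have "(c * norm x)\<^sup>2 \<le> (norm (blinfun_apply T ?y - N\<^sup>2 *\<^sub>R x))\<^sup>2"
      using c(2)[of x] c(1) by (intro power_mono) (simp_all add: blinfun.diff_left blinfun.scaleR_left)
    also have "\<dots> = (norm (blinfun_apply T ?y))\<^sup>2 - 2 * (N\<^sup>2 * (norm ?y)\<^sup>2) + N ^ 4 * (norm x)\<^sup>2"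
      by (simp add: norm_diff_squared cinner_scaleR_right self_adjointD[OF T] cinner_self
          power_mult_distrib)
    finally show ?thesis
      using TT by (simp add: power_mult_distrib algebra_simps)
  qed
  obtain x0 :: 'a where x0: "x0 \<noteq> 0" using nontrivial by blast
  have "0 \<le> N\<^sup>2 * (norm (blinfun_apply T x0))\<^sup>2" by simp
  also note key[of x0]
  finally have Nc: "0 \<le> N ^ 4 - c\<^sup>2"
    using x0 by (simp add: zero_le_mult_iff)
  with c(1) have "N \<noteq> 0" by auto
  then have N: "N > 0" by (simp add: N_def)
  define k where "k = (N ^ 4 - c\<^sup>2) / N\<^sup>2"
  have k: "0 \<le> k" "k < N\<^sup>2"
    using Nc N c(1) by (auto simp: k_def field_simps power2_eq_square power4_eq_xxxx)
  have "norm T \<le> sqrt k"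
  proof (rule norm_blinfun_bound)
    show "norm (blinfun_apply T x) \<le> sqrt k * norm x" for x
    proof (rule power2_le_imp_le)
      show "(norm (blinfun_apply T x))\<^sup>2 \<le> (sqrt k * norm x)\<^sup>2"
        using key[of x] N k by (simp add: power_mult_distrib k_def field_simps)
    qed (use k in simp)
  qed (use k in simp)
  also have "\<dots> < sqrt (N\<^sup>2)"
    using k by (intro real_sqrt_less_mono)
  finally show False using N by (simp add: N_def)
qed

text \<open>
  The norm of \<open>p(A)\<close> is attained by \<open>|p|\<close> on the spectrum, unless the space is zero.
\<close>

lemma norm_poly_op_le:
  fixes A :: "'a::complex_hilbert_space \<Rightarrow>\<^sub>L 'a"
  assumes A: "A \<in> self_adjoint_ops" and e: "0 \<le> e"
    and bound: "\<And>t. t \<in> real_spectrum A \<Longrightarrow> \<bar>poly p t\<bar> \<le> e"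
  shows "norm (poly_op p A) \<le> e"
proof (cases "\<exists>x::'a. x \<noteq> 0")
  case False
  then have "norm (blinfun_apply (poly_op p A) x) \<le> e * norm x" for x
    by (metis e mult_nonneg_nonneg norm_ge_zero norm_zero)
  then show ?thesis by (rule norm_blinfun_bound[OF e])
next
  case True
  have root: "\<exists>t\<in>real_spectrum A. (poly r t)\<^sup>2 = (norm (poly_op r A))\<^sup>2"
    if "r * r - [:(norm (poly_op r A))\<^sup>2:] \<noteq> 0" for r
  proof -
    let ?q = "r * r - [:(norm (poly_op r A))\<^sup>2:]"
    have "\<not> bounded_below (poly_op ?q A)"
      using not_bounded_below_norm[OF poly_op_self_adjoint[OF A] True]
      by (simp only: poly_op_diff poly_op_mult poly_op_const not_False_eq_True)
    then have "\<exists>t\<in>real_spectrum A. poly ?q t = 0"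
      using bounded_below_poly_op[OF A, of ?q] that by blast
    then show ?thesis by (auto simp: power2_eq_square)
  qed
  have "\<exists>t\<in>real_spectrum A. (poly p t)\<^sup>2 = (norm (poly_op p A))\<^sup>2"
  proof (cases "p * p - [:(norm (poly_op p A))\<^sup>2:] = 0")
    case True
    \<comment> \<open>Here \<open>p\<close> is constant, so any spectral point will do; the identity polynomial provides one.\<close>
    have "[:0, 1:] * [:0, 1:] - [:(norm (poly_op [:0, 1:] A))\<^sup>2:] \<noteq> 0"
      by simp
    from root[OF this] obtain t where "t \<in> real_spectrum A" by blast
    moreover have "poly (p * p - [:(norm (poly_op p A))\<^sup>2:]) t = 0"
      by (simp only: True poly_0)
    ultimately show ?thesis by (auto simp: power2_eq_square)
  qed (rule root)
  then show ?thesis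
    using bound e by (metis abs_le_square_iff abs_norm_cancel abs_of_nonneg order.trans order_refl)
qed

section \<open>The continuous functional calculus\<close>

lemma uniform_polynomial_approximation:
  fixes f :: "real \<Rightarrow> real"
  assumes "continuous_on {a..b} f"
  obtains p :: "nat \<Rightarrow> real poly" where "uniform_limit {a..b} (\<lambda>n. poly (p n)) f sequentially"
proof -
  obtain g where g: "uniform_limit {a..b} g f sequentially" "\<And>n. polynomial_function (g n)"
    using Stone_Weierstrass_uniform_limit[OF compact_Icc assms] by blast
  have "\<exists>p. poly p = g n" for n
  proof -
    obtain c k where "g n = (\<lambda>x. \<Sum>i\<le>k. c i * x ^ i)"
      using g(2)[of n] real_polynomial_function_iff_sum real_polynomial_function_eq by metis
    then have "poly (\<Sum>i\<le>k. monom (c i) i) = g n"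
      by (auto simp: poly_sum poly_monom)
    then show ?thesis by blast
  qed
  then obtain p where "\<And>n. poly (p n) = g n" by metis
  then have "(\<lambda>n. poly (p n)) = g" by auto
  with g(1) that show ?thesis by metis
qed

text \<open>
  Stated for two sequences so that it yields both the Cauchy property of one approximating
  sequence and the agreement of the limits of two.
\<close>

lemma poly_op_uniform_close:
  assumes A: "A \<in> self_adjoint_ops" and e: "e > 0"
    and p: "uniform_limit (real_spectrum A) (\<lambda>n. poly (p n)) f sequentially"
    and q: "uniform_limit (real_spectrum A) (\<lambda>n. poly (q n)) f sequentially"
  shows "\<exists>N. \<forall>j\<ge>N. \<forall>k\<ge>N. norm (poly_op (p j) A - poly_op (q k) A) < e"
proof -
  from e have e3: "e / 3 > 0" by simp
  obtain N1 where N1: "\<And>n t. n \<ge> N1 \<Longrightarrow> t \<in> real_spectrum A \<Longrightarrow> dist (poly (p n) t) (f t) < e / 3"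
    using p e3 unfolding uniform_limit_sequentially_iff by meson
  obtain N2 where N2: "\<And>n t. n \<ge> N2 \<Longrightarrow> t \<in> real_spectrum A \<Longrightarrow> dist (poly (q n) t) (f t) < e / 3"
    using q e3 unfolding uniform_limit_sequentially_iff by meson
  have "norm (poly_op (p j) A - poly_op (q k) A) < e" if "j \<ge> max N1 N2" "k \<ge> max N1 N2" for j k
  proof -
    have "norm (poly_op (p j - q k) A) \<le> 2 * (e / 3)"
    proof (rule norm_poly_op_le[OF A])
      fix t assume "t \<in> real_spectrum A"
      then have "dist (poly (p j) t) (f t) < e / 3" "dist (poly (q k) t) (f t) < e / 3"
        using N1[of j t] N2[of k t] that by auto
      then have "dist (poly (p j) t) (poly (q k) t) \<le> 2 * (e / 3)"
        using dist_triangle2[of "poly (p j) t" "poly (q k) t" "f t"] by linarith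
      then show "\<bar>poly (p j - q k) t\<bar> \<le> 2 * (e / 3)"
        by (simp add: dist_real_def)
    qed (use e in simp)
    with e show ?thesis by (simp add: poly_op_diff)
  qed
  then show ?thesis by blast
qed

text \<open>
  The functional calculus is well defined: some limit exists, and every sequence that
  approximates \<open>f\<close> on the spectrum has it.
\<close>

lemma poly_op_tendsto_cfc_spectrum:
  assumes sa: "A \<in> self_adjoint_ops"
    and p: "uniform_limit (real_spectrum A) (\<lambda>n. poly (p n)) f sequentially"
  shows "(\<lambda>n. poly_op (p n) A) \<longlonglongrightarrow> cfc f A"
proof -
  have "Cauchy (\<lambda>n. poly_op (p n) A)"
    using poly_op_uniform_close[OF sa _ p p] by (auto simp: Cauchy_iff)
  then obtain T where T: "(\<lambda>n. poly_op (p n) A) \<longlonglongrightarrow> T"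
    using Cauchy_convergent convergentD by blast
  have all: "(\<lambda>n. poly_op (q n) A) \<longlonglongrightarrow> T"
    if q: "uniform_limit (real_spectrum A) (\<lambda>n. poly (q n)) f sequentially" for q
  proof -
    have "(\<lambda>n. poly_op (q n) A - poly_op (p n) A) \<longlonglongrightarrow> 0"
      using poly_op_uniform_close[OF sa _ q p] by (fastforce simp: LIMSEQ_iff)
    from tendsto_add[OF this T] show ?thesis by simp
  qed
  have "cfc f A = T"
    unfolding cfc_def
  proof (rule the_equality)
    fix T' assume "\<forall>p. uniform_limit (real_spectrum A) (\<lambda>n. poly (p n)) f sequentially
        \<longrightarrow> (\<lambda>n. poly_op (p n) A) \<longlonglongrightarrow> T'"
    with p have "(\<lambda>n. poly_op (p n) A) \<longlonglongrightarrow> T'" by blast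
    with T show "T' = T" using LIMSEQ_unique by blast
  qed (use all in blast)
  with T show ?thesis by simp
qed

lemma poly_op_tendsto_cfc:
  assumes A: "spectral_bounds a b A"
    and p: "uniform_limit {a..b} (\<lambda>n. poly (p n)) f sequentially"
  shows "(\<lambda>n. poly_op (p n) A) \<longlonglongrightarrow> cfc f A"
proof (rule poly_op_tendsto_cfc_spectrum)
  show "A \<in> self_adjoint_ops"
    using A by (simp add: spectral_bounds_def)
  show "uniform_limit (real_spectrum A) (\<lambda>n. poly (p n)) f sequentially"
    by (rule uniform_limit_on_subset[OF p real_spectrum_subset[OF A]])
qed

lemma cfc_linear:
  assumes "spectral_bounds a b A"
  shows "cfc (\<lambda>t. c + d * t) A = scalar_op c + d *\<^sub>R A"
proof -
  have "(\<lambda>n. poly_op [:c, d:] A) \<longlonglongrightarrow> cfc (\<lambda>t. c + d * t) A"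
    by (rule poly_op_tendsto_cfc[OF assms]) (auto intro!: uniform_limitI simp: mult.commute)
  then show ?thesis
    by (simp add: poly_op_linear LIMSEQ_const_iff)
qed

lemma cfc_scaled_shift:
  assumes "spectral_bounds a b A"
  shows "cfc (\<lambda>t. k * (t - c)) A = k *\<^sub>R (A - scalar_op c)"
  using cfc_linear[OF assms, of "- (k * c)" k] by (simp add: algebra_simps)

lemma cfc_scaled_reflect:
  assumes "spectral_bounds a b A"
  shows "cfc (\<lambda>t. k * (c - t)) A = k *\<^sub>R (scalar_op c - A)"
  using cfc_linear[OF assms, of "k * c" "- k"] by (simp add: algebra_simps)

lemma cfc_add:
  assumes A: "spectral_bounds a b A" and f: "continuous_on {a..b} f" and g: "continuous_on {a..b} g"
  shows "cfc (\<lambda>t. f t + g t) A = cfc f A + cfc g A"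
proof -
  obtain p where p: "uniform_limit {a..b} (\<lambda>n. poly (p n)) f sequentially"
    using uniform_polynomial_approximation[OF f] .
  obtain q where q: "uniform_limit {a..b} (\<lambda>n. poly (q n)) g sequentially"
    using uniform_polynomial_approximation[OF g] .
  have "uniform_limit {a..b} (\<lambda>n. poly (p n + q n)) (\<lambda>t. f t + g t) sequentially"
    using uniform_limit_add[OF p q] by (simp add: poly_add[abs_def])
  then have "(\<lambda>n. poly_op (p n + q n) A) \<longlonglongrightarrow> cfc (\<lambda>t. f t + g t) A"
    by (rule poly_op_tendsto_cfc[OF A])
  moreover have "(\<lambda>n. poly_op (p n + q n) A) \<longlonglongrightarrow> cfc f A + cfc g A"
    unfolding poly_op_add
    by (intro tendsto_add poly_op_tendsto_cfc[OF A p] poly_op_tendsto_cfc[OF A q])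
  ultimately show ?thesis by (rule LIMSEQ_unique)
qed

lemma cfc_mult:
  assumes A: "spectral_bounds a b A" and f: "continuous_on {a..b} f" and g: "continuous_on {a..b} g"
  shows "cfc (\<lambda>t. f t * g t) A = cfc f A o\<^sub>L cfc g A"
proof -
  obtain p where p: "uniform_limit {a..b} (\<lambda>n. poly (p n)) f sequentially"
    using uniform_polynomial_approximation[OF f] .
  obtain q where q: "uniform_limit {a..b} (\<lambda>n. poly (q n)) g sequentially"
    using uniform_polynomial_approximation[OF g] .
  have "bounded (f ` {a..b})" "bounded (g ` {a..b})"
    by (intro compact_imp_bounded compact_continuous_image f g compact_Icc)+
  then have "uniform_limit {a..b} (\<lambda>n. poly (p n * q n)) (\<lambda>t. f t * g t) sequentially"
    using uniform_lim_mult[OF p q] by (simp add: poly_mult[abs_def])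
  then have "(\<lambda>n. poly_op (p n * q n) A) \<longlonglongrightarrow> cfc (\<lambda>t. f t * g t) A"
    by (rule poly_op_tendsto_cfc[OF A])
  moreover have "(\<lambda>n. poly_op (p n * q n) A) \<longlonglongrightarrow> (cfc f A o\<^sub>L cfc g A)"
    unfolding poly_op_mult
    by (intro bounded_bilinear.tendsto[OF bounded_bilinear_blinfun_compose]
        poly_op_tendsto_cfc[OF A p] poly_op_tendsto_cfc[OF A q])
  ultimately show ?thesis by (rule LIMSEQ_unique)
qed

lemma cfc_affine_substitution:
  assumes A: "spectral_bounds a b A" and A': "spectral_bounds a' b' (scalar_op c + d *\<^sub>R A)"
    and maps: "\<And>t. t \<in> {a..b} \<Longrightarrow> c + d * t \<in> {a'..b'}"
    and f: "continuous_on {a'..b'} f"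
  shows "cfc f (scalar_op c + d *\<^sub>R A) = cfc (\<lambda>t. f (c + d * t)) A"
proof -
  obtain p where p: "uniform_limit {a'..b'} (\<lambda>n. poly (p n)) f sequentially"
    using uniform_polynomial_approximation[OF f] .
  have "uniform_limit {a..b} (\<lambda>n. poly (pcompose (p n) [:c, d:])) (\<lambda>t. f (c + d * t)) sequentially"
    using uniform_limit_compose'[OF p, of "\<lambda>t. c + d * t" "{a..b}"] maps
    by (simp add: poly_pcompose[abs_def] Pi_iff mult.commute)
  then have "(\<lambda>n. poly_op (pcompose (p n) [:c, d:]) A) \<longlonglongrightarrow> cfc (\<lambda>t. f (c + d * t)) A"
    by (rule poly_op_tendsto_cfc[OF A])
  then have "(\<lambda>n. poly_op (p n) (scalar_op c + d *\<^sub>R A)) \<longlonglongrightarrow> cfc (\<lambda>t. f (c + d * t)) A"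
    by (simp add: poly_op_pcompose poly_op_linear)
  with poly_op_tendsto_cfc[OF A' p] show ?thesis
    by (rule LIMSEQ_unique)
qed

lemma spectral_bounds_reflect:
  assumes "spectral_bounds a b A"
  shows "spectral_bounds (c - b) (c - a) (scalar_op c - A)"
  unfolding spectral_bounds_def
proof (intro conjI)
  have A: "A \<in> self_adjoint_ops" "scalar_op a \<preceq> A" "A \<preceq> scalar_op b"
    using assms by (simp_all add: spectral_bounds_def)
  show "scalar_op c - A \<in> self_adjoint_ops"
    by (intro self_adjoint_diff scalar_op_self_adjoint A)
  show "scalar_op (c - b) \<preceq> scalar_op c - A"
    using A(3) by (rule op_le_cong_diff) (simp add: scaleR_diff_left)
  show "scalar_op c - A \<preceq> scalar_op (c - a)"
    using A(2) by (rule op_le_cong_diff) (simp add: scaleR_diff_left)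
qed

lemma spectral_bounds_shift:
  assumes "spectral_bounds a b A"
  shows "spectral_bounds (a - c) (b - c) (A - scalar_op c)"
  unfolding spectral_bounds_def
proof (intro conjI)
  have A: "A \<in> self_adjoint_ops" "scalar_op a \<preceq> A" "A \<preceq> scalar_op b"
    using assms by (simp_all add: spectral_bounds_def)
  show "A - scalar_op c \<in> self_adjoint_ops"
    by (intro self_adjoint_diff scalar_op_self_adjoint A)
  show "scalar_op (a - c) \<preceq> A - scalar_op c"
    using A(2) by (rule op_le_cong_diff) (simp add: scaleR_diff_left)
  show "A - scalar_op c \<preceq> scalar_op (b - c)"
    using A(3) by (rule op_le_cong_diff) (simp add: scaleR_diff_left)
qed

lemma cfc_reflect:
  assumes "spectral_bounds a b A" "continuous_on {c - b..c - a} f"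
  shows "cfc f (scalar_op c - A) = cfc (\<lambda>t. f (c - t)) A"
  using cfc_affine_substitution[OF assms(1), of "c - b" "c - a" c "- 1" f] assms(2)
    spectral_bounds_reflect[OF assms(1), of c] by simp

lemma cfc_shift:
  assumes "spectral_bounds a b A" "continuous_on {a - c..b - c} f"
  shows "cfc f (A - scalar_op c) = cfc (\<lambda>t. f (t - c)) A"
  using cfc_affine_substitution[OF assms(1), of "a - c" "b - c" "- c" 1 f] assms(2)
    spectral_bounds_shift[OF assms(1), of c] by simp

text \<open>
  Since \<open>h\<close> has a continuous square root, \<open>h(A)\<close> is a limit of squares of self-adjoint operators.
\<close>

lemma cfc_nonneg:
  assumes A: "spectral_bounds a b A" and h: "continuous_on {a..b} h"
    and nonneg: "\<And>t. t \<in> {a..b} \<Longrightarrow> 0 \<le> h t"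
  shows "0 \<preceq> cfc h A"
proof -
  have sa: "A \<in> self_adjoint_ops"
    using A by (simp add: spectral_bounds_def)
  have s: "continuous_on {a..b} (\<lambda>t. sqrt (h t))"
    by (intro continuous_intros h)
  obtain p where p: "uniform_limit {a..b} (\<lambda>n. poly (p n)) (\<lambda>t. sqrt (h t)) sequentially"
    using uniform_polynomial_approximation[OF s] .
  have "bounded ((\<lambda>t. sqrt (h t)) ` {a..b})"
    by (intro compact_imp_bounded compact_continuous_image s compact_Icc)
  then have "uniform_limit {a..b} (\<lambda>n t. poly (p n) t * poly (p n) t) (\<lambda>t. sqrt (h t) * sqrt (h t))
      sequentially"
    by (intro uniform_lim_mult p)
  then have "uniform_limit {a..b} (\<lambda>n. poly (p n * p n)) h sequentially"
    by (rule uniform_limit_cong'[THEN iffD1, rotated 2]) (simp_all add: nonneg)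
  then have "(\<lambda>n. poly_op (p n * p n) A) \<longlonglongrightarrow> cfc h A"
    by (rule poly_op_tendsto_cfc[OF A])
  moreover have "0 \<preceq> poly_op (p n * p n) A" for n
    by (simp add: op_le_def poly_op_mult cinner_self self_adjointD[OF poly_op_self_adjoint[OF sa]]
        del: of_real_power)
  ultimately show ?thesis
    by (rule op_le_tendsto[OF tendsto_const])
qed

lemma cfc_mono:
  assumes A: "spectral_bounds a b A" and f: "continuous_on {a..b} f" and g: "continuous_on {a..b} g"
    and le: "\<And>t. t \<in> {a..b} \<Longrightarrow> f t \<le> g t"
  shows "cfc f A \<preceq> cfc g A"
proof -
  have h: "continuous_on {a..b} (\<lambda>t. g t - f t)"
    by (intro continuous_intros f g)
  have "0 \<preceq> cfc (\<lambda>t. g t - f t) A"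
    using le by (intro cfc_nonneg[OF A h]) simp
  moreover have "cfc g A = cfc f A + cfc (\<lambda>t. g t - f t) A"
    using cfc_add[OF A f h] by simp
  ultimately show ?thesis
    by (simp add: op_le_def)
qed

section \<open>Superquadratic functions and their chords\<close>

text \<open>
  Written as constant plus slope times \<open>t\<close>, the form in which the functional calculus of an affine
  function is evaluated.
\<close>

definition chord :: "(real \<Rightarrow> real) \<Rightarrow> real \<Rightarrow> real \<Rightarrow> real \<Rightarrow> real" where
  "chord f m M t = (f m - (f M - f m) / (M - m) * m) + (f M - f m) / (M - m) * t"

text \<open>
  Base point \<open>t\<close>: the inequalities at \<open>m\<close> and \<open>M\<close> with weights \<open>M - t\<close> and \<open>t - m\<close> add up so that the
  slope \<open>c\<close> cancels.
\<close>

lemma superquadratic_le_chord: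
  assumes f: "superquadratic f" and t: "0 \<le> m" "m < M" "m \<le> t" "t \<le> M"
  shows "f t + (t - m) / (M - m) * f (M - t) + (M - t) / (M - m) * f (t - m) \<le> chord f m M t"
proof -
  obtain c where c: "\<And>u. u \<ge> 0 \<Longrightarrow> f u - f t - f \<bar>u - t\<bar> \<ge> c * (u - t)"
    using f t unfolding superquadratic_def by (meson order_trans)
  have 1: "(M - t) * (c * (m - t)) \<le> (M - t) * (f m - f t - f (t - m))"
    using c[of m] t by (intro mult_left_mono) auto
  have 2: "(t - m) * (c * (M - t)) \<le> (t - m) * (f M - f t - f (M - t))"
    using c[of M] t by (intro mult_left_mono) auto
  have "(M - m) * f t + (t - m) * f (M - t) + (M - t) * f (t - m) \<le> (M - t) * f m + (t - m) * f M"
    using 1 2 by (simp add: algebra_simps)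
  then have "((M - m) * f t + (t - m) * f (M - t) + (M - t) * f (t - m)) / (M - m)
      \<le> ((M - t) * f m + (t - m) * f M) / (M - m)"
    using t by (intro divide_right_mono) auto
  moreover have "((M - t) * f m + (t - m) * f M) / (M - m) = chord f m M t"
    using t by (simp add: chord_def divide_simps) (simp add: algebra_simps)
  ultimately show ?thesis
    using t by (simp add: add_divide_distrib)
qed

text \<open>
  Base point \<open>m\<close>: the inequality at \<open>M\<close> bounds the slope \<open>c\<close> from above, which suffices at \<open>t\<close>
  because \<open>t - m\<close> is not positive.
\<close>

lemma chord_le_superquadratic_left:
  assumes f: "superquadratic f" and t: "0 \<le> t" "t \<le> m" "m < M"
  shows "chord f m M t + f (m - t) + f (M - m) / (M - m) * (m - t) \<le> f t"
proof -
  obtain c where c: "\<And>u. u \<ge> 0 \<Longrightarrow> f u - f m - f \<bar>u - m\<bar> \<ge> c * (u - m)"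
    using f t unfolding superquadratic_def by (meson order_trans)
  have "c \<le> (f M - f m - f (M - m)) / (M - m)"
    using c[of M] t by (simp add: field_simps)
  then have "c * (m - t) \<le> (f M - f m - f (M - m)) / (M - m) * (m - t)"
    using t by (intro mult_right_mono) auto
  moreover have "f t \<ge> f m + f (m - t) - c * (m - t)"
    using c[of t] t by (simp add: algebra_simps)
  moreover have "f m + f (m - t) - (f M - f m - f (M - m)) / (M - m) * (m - t)
      = chord f m M t + f (m - t) + f (M - m) / (M - m) * (m - t)"
    using t by (simp add: chord_def divide_simps) (simp add: algebra_simps)
  ultimately show ?thesis by linarith
qed

text \<open>
  Base point \<open>M\<close>: the inequality at \<open>m\<close> bounds the slope \<open>c\<close> from below, which suffices at \<open>t\<close>
  because \<open>t - M\<close> is not negative.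
\<close>

lemma chord_le_superquadratic_right:
  assumes f: "superquadratic f" and t: "0 \<le> m" "m < M" "M \<le> t"
  shows "chord f m M t + f (t - M) + f (M - m) / (M - m) * (t - M) \<le> f t"
proof -
  obtain c where c: "\<And>u. u \<ge> 0 \<Longrightarrow> f u - f M - f \<bar>u - M\<bar> \<ge> c * (u - M)"
    using f t unfolding superquadratic_def by (meson order_trans less_imp_le)
  have "(f M - f m + f (M - m)) / (M - m) \<le> c"
    using c[of m] t by (simp add: field_simps)
  then have "(f M - f m + f (M - m)) / (M - m) * (t - M) \<le> c * (t - M)"
    using t by (intro mult_right_mono) auto
  moreover have "f t \<ge> f M + f (t - M) + c * (t - M)"
    using c[of t] t by (simp add: algebra_simps)
  moreover have "f M + f (t - M) + (f M - f m + f (M - m)) / (M - m) * (t - M)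
      = chord f m M t + f (t - M) + f (M - m) / (M - m) * (t - M)"
    using t by (simp add: chord_def divide_simps) (simp add: algebra_simps)
  ultimately show ?thesis by linarith
qed

section \<open>Operator versions of the chord inequalities\<close>

text \<open>
  The weights are affine and the shifted values are functions of \<open>B\<close>, so the left-hand side is a
  single function of \<open>B\<close> to which monotonicity applies.
\<close>

lemma cfc_le_chord:
  assumes f: "continuous_on {0..} f" "superquadratic f" and m: "0 \<le> m" "m < M"
    and B: "spectral_bounds m M B"
  shows "cfc f B + ((1 / (M - m)) *\<^sub>R (B - scalar_op m) o\<^sub>L cfc f (scalar_op M - B))
      + ((1 / (M - m)) *\<^sub>R (scalar_op M - B) o\<^sub>L cfc f (B - scalar_op m)) \<preceq> cfc (chord f m M) B"
proof -
  have cont: "continuous_on {m..M} f"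
    using m by (intro continuous_on_subset[OF f(1)]) auto
  have contR: "continuous_on {m..M} (\<lambda>t. f (M - t))" "continuous_on {m..M} (\<lambda>t. f (t - m))"
    by (intro continuous_on_compose2[OF f(1)] continuous_intros; auto)+
  have contW: "continuous_on {m..M} (\<lambda>t. (t - m) / (M - m))"
    "continuous_on {m..M} (\<lambda>t. (M - t) / (M - m))"
    using m by (intro continuous_intros; simp)+
  have W: "cfc (\<lambda>t. (t - m) / (M - m)) B = (1 / (M - m)) *\<^sub>R (B - scalar_op m)"
    "cfc (\<lambda>t. (M - t) / (M - m)) B = (1 / (M - m)) *\<^sub>R (scalar_op M - B)"
    using cfc_scaled_shift[OF B, of "1 / (M - m)" m] cfc_scaled_reflect[OF B, of "1 / (M - m)" M]
    by simp_all
  have R: "cfc f (scalar_op M - B) = cfc (\<lambda>t. f (M - t)) B"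
    "cfc f (B - scalar_op m) = cfc (\<lambda>t. f (t - m)) B"
    by (intro cfc_reflect[OF B] cfc_shift[OF B] continuous_on_subset[OF f(1)]; auto)+
  have "cfc f B + ((1 / (M - m)) *\<^sub>R (B - scalar_op m) o\<^sub>L cfc f (scalar_op M - B))
      + ((1 / (M - m)) *\<^sub>R (scalar_op M - B) o\<^sub>L cfc f (B - scalar_op m))
      = cfc (\<lambda>t. f t + (t - m) / (M - m) * f (M - t) + (M - t) / (M - m) * f (t - m)) B"
    unfolding R W[symmetric]
    by (simp only: cfc_add[OF B] cfc_mult[OF B] cont contR contW continuous_on_add continuous_on_mult)
  also have "\<dots> \<preceq> cfc (chord f m M) B"
    using superquadratic_le_chord[OF f(2) m]
    by (intro cfc_mono[OF B] continuous_on_add continuous_on_mult cont contR contW)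
       (use m in \<open>auto simp: chord_def intro!: continuous_intros\<close>)
  finally show ?thesis .
qed

lemma chord_le_cfc_left:
  assumes f: "continuous_on {0..} f" "superquadratic f" and m: "m < M"
    and A: "spectral_bounds 0 m A"
  shows "cfc (chord f m M) A + cfc f (scalar_op m - A)
      + (f (M - m) / (M - m)) *\<^sub>R (scalar_op m - A) \<preceq> cfc f A"
proof -
  have cont: "continuous_on {0..m} f" "continuous_on {0..m} (\<lambda>t. f (m - t))"
    "continuous_on {0..m} (chord f m M)" "continuous_on {0..m} (\<lambda>t. f (M - m) / (M - m) * (m - t))"
    using m
    by (auto intro!: continuous_on_compose2[OF f(1)] continuous_intros simp: chord_def[abs_def])
  have W: "cfc (\<lambda>t. f (M - m) / (M - m) * (m - t)) A = (f (M - m) / (M - m)) *\<^sub>R (scalar_op m - A)"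
    by (rule cfc_scaled_reflect[OF A])
  have R: "cfc f (scalar_op m - A) = cfc (\<lambda>t. f (m - t)) A"
    by (intro cfc_reflect[OF A] continuous_on_subset[OF f(1)]) auto
  have "cfc (chord f m M) A + cfc f (scalar_op m - A) + (f (M - m) / (M - m)) *\<^sub>R (scalar_op m - A)
      = cfc (\<lambda>t. chord f m M t + f (m - t) + f (M - m) / (M - m) * (m - t)) A"
    unfolding R W[symmetric] by (simp only: cfc_add[OF A] cont continuous_on_add)
  also have "\<dots> \<preceq> cfc f A"
    using chord_le_superquadratic_left[OF f(2) _ _ m]
    by (intro cfc_mono[OF A] continuous_on_add cont) auto
  finally show ?thesis .
qed

lemma chord_le_cfc_right:
  assumes f: "continuous_on {0..} f" "superquadratic f" and m: "0 \<le> m" "m < M"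
    and D: "spectral_bounds M R D"
  shows "cfc (chord f m M) D + cfc f (D - scalar_op M)
      + (f (M - m) / (M - m)) *\<^sub>R (D - scalar_op M) \<preceq> cfc f D"
proof -
  have cont: "continuous_on {M..R} f" "continuous_on {M..R} (\<lambda>t. f (t - M))"
    "continuous_on {M..R} (chord f m M)" "continuous_on {M..R} (\<lambda>t. f (M - m) / (M - m) * (t - M))"
    using m by (auto intro!: continuous_on_compose2[OF f(1)] continuous_intros simp: chord_def[abs_def])
  have W: "cfc (\<lambda>t. f (M - m) / (M - m) * (t - M)) D = (f (M - m) / (M - m)) *\<^sub>R (D - scalar_op M)"
    by (rule cfc_scaled_shift[OF D])
  have R: "cfc f (D - scalar_op M) = cfc (\<lambda>t. f (t - M)) D"
    by (intro cfc_shift[OF D] continuous_on_subset[OF f(1)]) auto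
  have "cfc (chord f m M) D + cfc f (D - scalar_op M) + (f (M - m) / (M - m)) *\<^sub>R (D - scalar_op M)
      = cfc (\<lambda>t. chord f m M t + f (t - M) + f (M - m) / (M - m) * (t - M)) D"
    unfolding R W[symmetric] by (simp only: cfc_add[OF D] cont continuous_on_add)
  also have "\<dots> \<preceq> cfc f D"
    using chord_le_superquadratic_right[OF f(2) m]
    by (intro cfc_mono[OF D] continuous_on_add cont) auto
  finally show ?thesis .
qed

theorem theorem3p6:
  fixes f :: "real \<Rightarrow> real"
    and A B C D :: "'a::complex_hilbert_space \<Rightarrow>\<^sub>L 'a"
    and m M :: real
  assumes "continuous_on {0..} f"
    and "superquadratic f"
    and "A \<in> self_adjoint_ops" "B \<in> self_adjoint_ops"
      "C \<in> self_adjoint_ops" "D \<in> self_adjoint_ops"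
    and "0 \<le> m" "m < M"
    and "0 \<preceq> A" "A \<preceq> scalar_op m" "scalar_op m \<preceq> B" "B \<preceq> scalar_op M" "scalar_op M \<preceq> D"
    and "scalar_op m \<preceq> C" "C \<preceq> scalar_op M"
    and "(B + C \<preceq> A + D \<and> f m \<le> f M) \<or> (A + D \<preceq> B + C \<and> f M \<le> f m)"
  shows
    "cfc f B + cfc f C
       + ((1 / (M - m)) *\<^sub>R (B - scalar_op m) o\<^sub>L cfc f (scalar_op M - B))
       + ((1 / (M - m)) *\<^sub>R (scalar_op M - C) o\<^sub>L cfc f (C - scalar_op m))
       + ((1 / (M - m)) *\<^sub>R (C - scalar_op m) o\<^sub>L cfc f (scalar_op M - C))
       + ((1 / (M - m)) *\<^sub>R (scalar_op M - B) o\<^sub>L cfc f (B - scalar_op m))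
     \<preceq> cfc f A + cfc f D
       - cfc f (scalar_op m - A) - (f (M - m) / (M - m)) *\<^sub>R (scalar_op m - A)
       - cfc f (D - scalar_op M) - (f (M - m) / (M - m)) *\<^sub>R (D - scalar_op M)"
proof -
  note f = assms(1,2) and m = assms(7,8)
  \<comment> \<open>Only \<open>D\<close> lacks an upper bound among the hypotheses.\<close>
  have D_bound: "D \<preceq> scalar_op (norm D)"
    by (rule op_le_norm[OF assms(6)])
  have A: "spectral_bounds 0 m A" and B: "spectral_bounds m M B" and C: "spectral_bounds m M C"
    and D: "spectral_bounds M (norm D) D"
    using assms(3-6,9-15) D_bound by (simp_all add: spectral_bounds_def)
  define \<sigma> where "\<sigma> = (f M - f m) / (M - m)"
  have chord_A: "cfc (chord f m M) A = scalar_op (f m - \<sigma> * m) + \<sigma> *\<^sub>R A"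
    and chord_B: "cfc (chord f m M) B = scalar_op (f m - \<sigma> * m) + \<sigma> *\<^sub>R B"
    and chord_C: "cfc (chord f m M) C = scalar_op (f m - \<sigma> * m) + \<sigma> *\<^sub>R C"
    and chord_D: "cfc (chord f m M) D = scalar_op (f m - \<sigma> * m) + \<sigma> *\<^sub>R D"
    unfolding chord_def[abs_def] \<sigma>_def[symmetric]
    by (rule cfc_linear[OF A] cfc_linear[OF B] cfc_linear[OF C] cfc_linear[OF D])+
  \<comment> \<open>The sign of the slope matches the direction of the operator inequality in both alternatives.\<close>
  have "\<sigma> *\<^sub>R (B + C) \<preceq> \<sigma> *\<^sub>R (A + D)"
    using assms(16)
  proof
    assume "B + C \<preceq> A + D \<and> f m \<le> f M"
    then show ?thesis
      using m by (intro op_le_scaleR) (auto simp: \<sigma>_def)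
  next
    assume *: "A + D \<preceq> B + C \<and> f M \<le> f m"
    then have "(- \<sigma>) *\<^sub>R (A + D) \<preceq> (- \<sigma>) *\<^sub>R (B + C)"
      using m by (intro op_le_scaleR) (auto simp: \<sigma>_def divide_le_0_iff)
    then show ?thesis
      by (rule op_le_cong_diff) (simp add: algebra_simps)
  qed
  then have chords: "cfc (chord f m M) B + cfc (chord f m M) C
      \<preceq> cfc (chord f m M) A + cfc (chord f m M) D"
    unfolding chord_A chord_B chord_C chord_D
    by (rule op_le_cong_diff) (simp add: algebra_simps)
  note inner = op_le_trans[OF op_le_add[OF cfc_le_chord[OF f m B] cfc_le_chord[OF f m C]] chords]
  note outer = op_le_add[OF chord_le_cfc_left[OF f m(2) A] chord_le_cfc_right[OF f m D]]
  show ?thesis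
    by (rule op_le_cong_diff[OF op_le_add[OF inner outer]]) (simp add: algebra_simps)
qed

end
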